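(* Let $n>1$ and let $\mathscr{L}=\mathscr{L}(s,\mathbf{u},\mathbf{p})$ be a smooth first-order Lagrangian. If $\mathscr{L}$ is an $\mathcal{N}$-Lagrangian, then $\mathscr{L}$ has the local representation $$\mathscr{L}(s,\mathbf{u},\mathbf{u}')=\mathbf{u}'\cdot\mathbf{A}(s,\mathbf{u})+C(s,\mathbf{u})$$ for some functions $\mathbf{A}=(A_1,\dots,A_n)$ ($\mathbb{R}^n$-valued) and $C$ (real-valued) of the variables $(s,\mathbf{u})$ only.
   Context: A first-order Lagrangian is a smooth function $\mathscr{L}(s,\mathbf{u},\mathbf{p})$ of $s\in[0,1]$, $\mathbf{u}\in\mathbb{R}^n$, $\mathbf{p}\in\mathbb{R}^n\setminus\{\mathbf{0}\}$ ($\mathbf{p}$ stands for $\mathbf{u}'$); its functional is $\mathcal{E}(\mathbf{u})=\int_0^1\mathscr{L}(s,\mathbf{u}(s),\mathbf{u}'(s))\,ds$. Let $\mathcal{C}^2_R$ be the set of $\mathbf{u}\in C^2([0,1];\mathbb{R}^n)$ with $\mathbf{u}'(s)\neq\mathbf{0}$ for all $s$, and let $\mathcal{C}^\infty_c$ be the smooth functions $[0,1]\to\mathbb{R}^n$ with compact support in $(0,1)$. The first variation is $\delta\mathcal{E}[\delta\mathbf{u}]=\int_0^1(\mathscr{L}_{\mathbf{u}}\cdot\delta\mathbf{u}+\mathscr{L}_{\mathbf{u}'}\cdot\delta\mathbf{u}')\,ds$, where $\mathscr{L}_{\mathbf{u}},\mathscr{L}_{\mathbf{u}'}$ are the gradients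 of $\mathscr{L}$ in $\mathbf{u}$ and $\mathbf{p}$ evaluated at $(s,\mathbf{u}(s),\mathbf{u}'(s))$. For $\mathbf{u}\in\mathcal{C}^2_R$ the set of normal variations is $N_{\mathbf{u}}=\{\mathbf{v}\in\mathcal{C}^\infty_c:\mathbf{v}\cdot\mathbf{u}'=0\}$. $\mathscr{L}$ is an $\mathcal{N}$-Lagrangian if for every $\mathbf{u}\in\mathcal{C}^2_R$, $\delta\mathcal{E}[\delta\mathbf{u}]=0$ for all $\delta\mathbf{u}\in N_{\mathbf{u}}$. "Local representation" means that the identity holds, as an identity between functions of $(s,\mathbf{u},\mathbf{p})$ with $\mathbf{p}=\mathbf{u}'$, in a neighbourhood of each point $(s_0,\mathbf{u}_0,\mathbf{p}_0)$ of the domain of $\mathscr{L}$. *)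

theory Defs
  imports "HOL-Analysis.Analysis"
begin

text \<open>
  \<open>Ck_on k S f\<close>: the derivatives of \<open>f\<close> up to order \<open>k\<close> within \<open>S\<close> exist and are continuous on \<open>S\<close>.
  Continuity of \<open>f'\<close> is required direction by direction, which is the same as continuity in operator
  norm because all domains below are finite-dimensional. On the sets used below the derivative within
  the set is unique, so the existential picks out the usual (at boundary points, one-sided) derivative.
\<close>

primrec Ck_on :: "nat \<Rightarrow> 'a::real_normed_vector set \<Rightarrow> ('a \<Rightarrow> 'b::real_normed_vector) \<Rightarrow> bool" where
  "Ck_on 0 S f \<longleftrightarrow> continuous_on S f"
| "Ck_on (Suc k) S f \<longleftrightarrow>
     (\<exists>f'. (\<forall>x\<in>S. (f has_derivative f' x) (at x within S)) \<and> (\<forall>v. Ck_on k S (\<lambda>x. f' x v)))"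

definition smooth_on :: "'a::real_normed_vector set \<Rightarrow> ('a \<Rightarrow> 'b::real_normed_vector) \<Rightarrow> bool" where
  "smooth_on S f \<longleftrightarrow> (\<forall>k. Ck_on k S f)"

definition grad :: "('a::real_inner \<Rightarrow> real) \<Rightarrow> 'a \<Rightarrow> 'a" where
  "grad f x = (THE D. GDERIV f x :> D)"

definition lagrangian_domain :: "(real \<times> (real ^ 'n) \<times> (real ^ 'n)) set" where
  "lagrangian_domain = {0..1} \<times> UNIV \<times> (UNIV - {0})"

definition smooth_lagrangian :: "(real \<Rightarrow> real ^ 'n \<Rightarrow> real ^ 'n \<Rightarrow> real) \<Rightarrow> bool" where
  "smooth_lagrangian L \<longleftrightarrow> smooth_on lagrangian_domain (\<lambda>(s, u, p). L s u p)"

abbreviation deriv01 :: "(real \<Rightarrow> real ^ 'n) \<Rightarrow> real \<Rightarrow> real ^ 'n" where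
  "deriv01 u s \<equiv> vector_derivative u (at s within {0..1})"

definition C2_R :: "(real \<Rightarrow> real ^ 'n) set" where
  "C2_R = {u. Ck_on 2 {0..1} u \<and> (\<forall>s\<in>{0..1}. deriv01 u s \<noteq> 0)}"

text \<open>Boundedness of \<open>{0..1}\<close> makes the support below compact.\<close>

definition Cinf_c :: "(real \<Rightarrow> real ^ 'n) set" where
  "Cinf_c = {v. smooth_on {0..1} v \<and> closure (support_on {0..1} v) \<subseteq> {0<..<1}}"

definition normal_variations :: "(real \<Rightarrow> real ^ 'n) \<Rightarrow> (real \<Rightarrow> real ^ 'n) set" where
  "normal_variations u = {v \<in> Cinf_c. \<forall>s\<in>{0..1}. v s \<bullet> deriv01 u s = 0}"

definition first_variation ::
    "(real \<Rightarrow> real ^ 'n \<Rightarrow> real ^ 'n \<Rightarrow> real) \<Rightarrow> (real \<Rightarrow> real ^ 'n) \<Rightarrow> (real \<Rightarrow> real ^ 'n) \<Rightarrow> real" where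
  "first_variation L u v =
     integral {0..1} (\<lambda>s. grad (\<lambda>w. L s w (deriv01 u s)) (u s) \<bullet> v s
                        + grad (\<lambda>q. L s (u s) q) (deriv01 u s) \<bullet> deriv01 v s)"

definition N_lagrangian :: "(real \<Rightarrow> real ^ 'n \<Rightarrow> real ^ 'n \<Rightarrow> real) \<Rightarrow> bool" where
  "N_lagrangian L \<longleftrightarrow> (\<forall>u\<in>C2_R. \<forall>v\<in>normal_variations u. first_variation L u v = 0)"

end

theory Submission
  imports Defs "HOL-Computational_Algebra.Polynomial"
begin

text \<open>
  Test the hypothesis on the curves \<open>u(s) = u0 + (s - s0) p0 + (s - s0)\<^sup>2 q / 2\<close> with the variations
  \<open>\<phi> J u'\<close>, where \<open>J\<close> is a skew endomorphism and \<open>\<phi>\<close> a bump function. Integration by parts and the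
  fundamental lemma of the calculus of variations give, at \<open>(s0, u0, p0)\<close>, an identity
  \<open>L\<^sub>u \<cdot> J p0 = (L\<^sub>p\<^sub>s + L\<^sub>p\<^sub>u p0 + L\<^sub>p\<^sub>p q) \<cdot> J p0\<close> in which \<open>q\<close> is free, so \<open>J p0 \<cdot> L\<^sub>p\<^sub>p q = 0\<close>. Since \<open>J p0\<close> is
  an arbitrary vector orthogonal to \<open>p0\<close>, the Hessian \<open>L\<^sub>p\<^sub>p\<close> only has a radial-radial part. Then \<open>L\<^sub>p\<close>
  is constant on spheres, and since \<open>n > 1\<close> comparing orthogonal rays removes that part too. Hence
  \<open>L\<close> is affine in \<open>p\<close> on every ball avoiding \<open>0\<close>.
\<close>

subsection \<open>Smooth bump functions\<close>

lemma Ck_on_cong: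
  assumes "Ck_on k S f" and "\<And>x. x \<in> S \<Longrightarrow> f x = g x"
  shows "Ck_on k S g"
proof (cases k)
  case 0
  then show ?thesis using assms by (simp cong: continuous_on_cong)
next
  case (Suc m)
  then obtain f' where f': "\<forall>x\<in>S. (f has_derivative f' x) (at x within S)"
    "\<forall>v. Ck_on m S (\<lambda>x. f' x v)"
    using assms(1) by auto
  have "\<forall>x\<in>S. (g has_derivative f' x) (at x within S)"
    using f'(1) assms(2) by (metis has_derivative_transform)
  then show ?thesis using f'(2) Suc by auto
qed

lemma Ck_on_Suc_imp: "Ck_on (Suc k) S f \<Longrightarrow> Ck_on k S f"
proof (induction k arbitrary: f)
  case 0
  then show ?case
    by (auto simp: continuous_on_eq_continuous_within intro: has_derivative_continuous)
next
  case (Suc k)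
  then obtain f' where "\<forall>x\<in>S. (f has_derivative f' x) (at x within S)"
    "\<forall>v. Ck_on (Suc k) S (\<lambda>x. f' x v)"
    using Ck_on.simps(2) by blast
  then show ?case using Suc.IH by (subst Ck_on.simps) blast
qed

lemma Ck_on_const: "Ck_on k S (\<lambda>x. c)"
proof (induction k arbitrary: c)
  case (Suc k)
  show ?case
    by (subst Ck_on.simps, rule exI[of _ "\<lambda>x v. 0"]) (auto simp: Suc)
qed auto

lemma Ck_on_ident: "Ck_on k S (\<lambda>x. x)"
proof (cases k)
  case (Suc m)
  show ?thesis unfolding Suc
    by (subst Ck_on.simps, rule exI[of _ "\<lambda>x v. v"]) (auto simp: Ck_on_const)
qed auto

lemma Ck_on_add:
  "Ck_on k S f \<Longrightarrow> Ck_on k S g \<Longrightarrow> Ck_on k S (\<lambda>x. f x + g x)"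
proof (induction k arbitrary: f g)
  case 0
  then show ?case by (simp add: continuous_on_add)
next
  case (Suc k)
  obtain f' where f': "\<forall>x\<in>S. (f has_derivative f' x) (at x within S)"
    "\<forall>v. Ck_on k S (\<lambda>x. f' x v)" using Suc.prems(1) by auto
  obtain g' where g': "\<forall>x\<in>S. (g has_derivative g' x) (at x within S)"
    "\<forall>v. Ck_on k S (\<lambda>x. g' x v)" using Suc.prems(2) by auto
  show ?case
    by (subst Ck_on.simps, rule exI[of _ "\<lambda>x v. f' x v + g' x v"])
      (use f' g' Suc.IH in \<open>auto intro: has_derivative_add\<close>)
qed

lemma Ck_on_scaleR:
  fixes f :: "'a::real_normed_vector \<Rightarrow> real" and g :: "'a \<Rightarrow> 'b::real_normed_vector"
  shows "Ck_on k S f \<Longrightarrow> Ck_on k S g \<Longrightarrow> Ck_on k S (\<lambda>x. f x *\<^sub>R g x)"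
proof (induction k arbitrary: f g)
  case 0
  then show ?case by (simp add: continuous_on_scaleR)
next
  case (Suc k)
  obtain f' where f': "\<forall>x\<in>S. (f has_derivative f' x) (at x within S)"
    "\<forall>v. Ck_on k S (\<lambda>x. f' x v)" using Suc.prems(1) by auto
  obtain g' where g': "\<forall>x\<in>S. (g has_derivative g' x) (at x within S)"
    "\<forall>v. Ck_on k S (\<lambda>x. g' x v)" using Suc.prems(2) by auto
  have fg: "Ck_on k S f" "Ck_on k S g"
    using Suc.prems by (auto intro: Ck_on_Suc_imp simp del: Ck_on.simps)
  show ?case
    by (subst Ck_on.simps, rule exI[of _ "\<lambda>x v. f x *\<^sub>R g' x v + f' x v *\<^sub>R g x"])
      (use f' g' fg Suc.IH in \<open>auto intro!: has_derivative_scaleR Ck_on_add\<close>)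
qed

text \<open>The polynomial parameter makes the family closed under differentiation, so smoothness
  becomes an induction on the order with \<open>P\<close> arbitrary.\<close>

definition flat_exp :: "real poly \<Rightarrow> real \<Rightarrow> real" where
  "flat_exp P x = (if x > 0 then poly P (1 / x) * exp (- (1 / x)) else 0)"

text \<open>The power \<open>y ^ k\<close> strengthens the induction: peeling off one coefficient
  raises \<open>k\<close> by one and leaves a multiple of \<open>y ^ k / exp y\<close>.\<close>

lemma tendsto_poly_mult_exp_neg:
  fixes P :: "real poly"
  shows "((\<lambda>y. y ^ k * poly P y * exp (- y)) \<longlongrightarrow> 0) at_top"
proof (induction P arbitrary: k)
  case 0
  then show ?case by simp
next
  case (pCons a P)
  have "((\<lambda>y. a * (y ^ k / exp y) + y ^ Suc k * poly P y * exp (- y)) \<longlongrightarrow> a * 0 + 0) at_top"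
    by (intro tendsto_intros tendsto_power_div_exp_0 pCons.IH)
  then show ?case
    by (simp add: exp_minus field_simps)
qed

lemma flat_exp_tendsto_0:
  "(flat_exp P \<longlongrightarrow> 0) (at 0)"
proof -
  have "((\<lambda>x. poly P (inverse x) * exp (- inverse x)) \<longlongrightarrow> 0) (at_right (0::real))"
    using filterlim_compose[OF tendsto_poly_mult_exp_neg[of 0 P] filterlim_inverse_at_top_right]
    by simp
  moreover have "eventually (\<lambda>x. poly P (inverse x) * exp (- inverse x) = flat_exp P x) (at_right 0)"
    unfolding eventually_at_right_field
    by (intro exI[of _ 1] conjI allI impI) (simp_all only: flat_exp_def inverse_eq_divide if_True zero_less_one)
  ultimately have "(flat_exp P \<longlongrightarrow> 0) (at_right 0)"
    by (rule Lim_transform_eventually)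
  moreover have "eventually (\<lambda>x. 0 = flat_exp P x) (at_left 0)"
    unfolding eventually_at_left_field
    by (intro exI[of _ "-1"] conjI allI impI) (simp_all add: flat_exp_def)
  then have "(flat_exp P \<longlongrightarrow> 0) (at_left 0)"
    by (rule Lim_transform_eventually[OF tendsto_const])
  ultimately show ?thesis
    by (simp add: filterlim_at_split)
qed

text \<open>Both factors depend on \<open>1 / x\<close>, whose derivative \<open>- (1 / x)^2\<close>
  accounts for the two leading zeros; the exponential contributes \<open>P\<close> and the
  polynomial \<open>- pderiv P\<close>.\<close>

lemma has_real_derivative_flat_exp:
  "(flat_exp P has_real_derivative flat_exp (pCons 0 (pCons 0 (P - pderiv P))) x) (at x)"
proof -
  consider "x > 0" | "x < 0" | "x = 0" by linarith
  then show ?thesis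
  proof cases
    case 1
    have inv: "((\<lambda>x. 1 / x) has_real_derivative - (1 / x * (1 / x))) (at x)"
      using DERIV_inverse[of x UNIV] 1 by (simp add: inverse_eq_divide power2_eq_square)
    have "((\<lambda>x. poly P (1 / x) * exp (- (1 / x))) has_real_derivative
        poly (pderiv P) (1 / x) * (- (1 / x * (1 / x))) * exp (- (1 / x)) +
        exp (- (1 / x)) * (- (- (1 / x * (1 / x)))) * poly P (1 / x)) (at x)"
      by (intro DERIV_mult DERIV_chain2[OF poly_DERIV inv] DERIV_chain2[OF DERIV_exp DERIV_minus[OF inv]])
    also have "poly (pderiv P) (1 / x) * (- (1 / x * (1 / x))) * exp (- (1 / x)) +
        exp (- (1 / x)) * (- (- (1 / x * (1 / x)))) * poly P (1 / x) =
        flat_exp (pCons 0 (pCons 0 (P - pderiv P))) x"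
      using 1 by (simp add: flat_exp_def algebra_simps)
    finally have "((\<lambda>x. poly P (1 / x) * exp (- (1 / x))) has_real_derivative
        flat_exp (pCons 0 (pCons 0 (P - pderiv P))) x) (at x)" .
    then show ?thesis
      by (rule has_field_derivative_transform_within_open[where S = "{0<..}"])
        (use 1 in \<open>auto simp: flat_exp_def\<close>)
  next
    case 2
    have "((\<lambda>x. 0) has_real_derivative flat_exp (pCons 0 (pCons 0 (P - pderiv P))) x) (at x)"
      using 2 by (auto simp: flat_exp_def)
    then show ?thesis
      by (rule has_field_derivative_transform_within_open[where S = "{..<0}"])
        (use 2 in \<open>auto simp: flat_exp_def\<close>)
  next
    case 3
    \<comment> \<open>At the gluing point, dividing by \<open>h\<close> multiplies by
      \<open>1 / h\<close>, so the difference quotient is again a flat function and tends to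
      0.\<close>
    have "(\<lambda>h. (flat_exp P h - flat_exp P 0) / (h - 0)) = flat_exp (pCons 0 P)"
      by (auto simp: flat_exp_def field_simps)
    then have "(flat_exp P has_real_derivative 0) (at 0)"
      using flat_exp_tendsto_0[of "pCons 0 P"]
      by (simp add: has_field_derivative_iff)
    then show ?thesis using 3 by (simp add: flat_exp_def)
  qed
qed

lemma Ck_on_flat_exp: "Ck_on k S (\<lambda>x. flat_exp P (c + m * x))"
proof (induction k arbitrary: P)
  case 0
  have "isCont (flat_exp P) x" for x
    using has_real_derivative_flat_exp DERIV_isCont by blast
  then have "continuous_on UNIV (flat_exp P)"
    by (simp add: continuous_on_eq_continuous_at)
  then have "continuous_on S (\<lambda>x. flat_exp P (c + m * x))"
    by (rule continuous_on_compose2) (auto intro: continuous_intros)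
  then show ?case by simp
next
  case (Suc k)
  let ?Q = "pCons 0 (pCons 0 (P - pderiv P))"
  have "((\<lambda>x. flat_exp P (c + m * x)) has_real_derivative flat_exp ?Q (c + m * x) * m) (at x within S)"
    for x
    by (rule DERIV_chain2[OF has_real_derivative_flat_exp])
      (auto intro!: derivative_eq_intros)
  then have "((\<lambda>x. flat_exp P (c + m * x)) has_derivative (\<lambda>v. flat_exp ?Q (c + m * x) *\<^sub>R (m * v))) (at x within S)"
    for x
    by (simp add: has_field_derivative_def mult.assoc [symmetric])
  then show ?case
    by (subst Ck_on.simps,
        intro exI[of _ "\<lambda>x v. flat_exp ?Q (c + m * x) *\<^sub>R (m * v)"])
      (auto intro!: Ck_on_scaleR Ck_on_const Suc simp del: real_scaleR_def)
qed

lemma smooth_bump_exists: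
  fixes a b :: real
  assumes "a < b"
  obtains \<phi> \<phi>' :: "real \<Rightarrow> real" where "\<And>k S. Ck_on k S \<phi>"
    "\<And>x. (\<phi> has_real_derivative \<phi>' x) (at x)" "continuous_on UNIV \<phi>'"
    "\<And>x. x \<in> {a<..<b} \<Longrightarrow> \<phi> x > 0" "\<And>x. x \<notin> {a<..<b} \<Longrightarrow> \<phi> x = 0"
proof -
  \<comment> \<open>The first factor vanishes up to \<open>a\<close>, the second from
    \<open>b\<close> on. The affine arguments match \<open>Ck_on_flat_exp\<close>.\<close>
  define \<phi> where "\<phi> = (\<lambda>x. flat_exp 1 (- a + 1 * x) *\<^sub>R flat_exp 1 (b + (- 1) * x))"
  have C: "Ck_on k S \<phi>" for k S
    unfolding \<phi>_def by (intro Ck_on_scaleR Ck_on_flat_exp)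
  then have "Ck_on (Suc 0) UNIV \<phi>" .
  then obtain D where D: "\<And>x. (\<phi> has_derivative D x) (at x)" "\<And>v. continuous_on UNIV (\<lambda>x. D x v)"
    by auto
  have "(\<phi> has_real_derivative D x 1) (at x)" for x
  proof -
    have "D x = (\<lambda>h. D x 1 * h)"
    proof
      fix h
      have "D x (h *\<^sub>R 1) = h *\<^sub>R D x 1"
        by (rule linear_scale[OF has_derivative_linear[OF D(1)]])
      then show "D x h = D x 1 * h" by simp
    qed
    then show ?thesis using D(1)[of x] by (simp add: has_field_derivative_def)
  qed
  moreover have "\<phi> x > 0" if "x \<in> {a<..<b}" for x
    using that by (auto simp: \<phi>_def flat_exp_def)
  moreover have "\<phi> x = 0" if "x \<notin> {a<..<b}" for x
    using that by (auto simp: \<phi>_def flat_exp_def)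
  ultimately show ?thesis using that[of \<phi> "\<lambda>x. D x 1", OF C] D(2) by simp
qed

subsection \<open>Calculus of variations\<close>

text \<open>If \<open>g\<close> were nonzero at an interior point, a bump concentrated where
  \<open>g\<close> keeps its sign would give a nonzero integral. Continuity carries the result to
  the end points.\<close>

lemma fundamental_lemma_variations:
  fixes g :: "real \<Rightarrow> real"
  assumes g: "continuous_on {0..1} g"
    and bump: "\<And>a b. 0 < a \<Longrightarrow> a < b \<Longrightarrow> b < 1 \<Longrightarrow>
      \<exists>\<phi>. continuous_on UNIV \<phi> \<and> (\<forall>x\<in>{a<..<b}. \<phi> x > (0::real)) \<and> (\<forall>x. x \<notin> {a<..<b} \<longrightarrow> \<phi> x = 0) \<and>
        integral {0..1} (\<lambda>s. \<phi> s * g s) = 0"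
    and s: "s \<in> {0..1}"
  shows "g s = 0"
proof -
  have inner: "g s = 0" if s: "s \<in> {0<..<1}" for s
  proof (rule ccontr)
    assume nz: "g s \<noteq> 0"
    have "isCont g s"
      using continuous_on_interior[OF g, of s] s by (simp add: interior_atLeastAtMost_real)
    then obtain d where d: "d > 0" "\<And>t. dist t s < d \<Longrightarrow> dist (g t) (g s) < \<bar>g s\<bar>"
      using nz unfolding continuous_at_eps_delta by (metis dist_real_def zero_less_abs_iff)
    define e where "e = min d (min s (1 - s)) / 2"
    have e: "0 < e" "e < d" "0 < s - e" "s + e < 1"
      using d(1) s by (auto simp: e_def min_def field_simps)
    obtain \<phi> where \<phi>: "continuous_on UNIV \<phi>" "\<And>x. x \<in> {s - e<..<s + e} \<Longrightarrow> \<phi> x > (0::real)"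
        "\<And>x. x \<notin> {s - e<..<s + e} \<Longrightarrow> \<phi> x = 0" and int0: "integral {0..1} (\<lambda>s. \<phi> s * g s) = 0"
      using bump[of "s - e" "s + e"] e by auto
    \<comment> \<open>The constant factor \<open>g s\<close> treats both signs of \<open>g s\<close>
      at once.\<close>
    have pos: "\<phi> t * g t * g s \<ge> 0" for t
    proof (cases "t \<in> {s - e<..<s + e}")
      case True
      then have "\<bar>g t - g s\<bar> < \<bar>g s\<bar>" using d(2)[of t] e by (auto simp: dist_real_def abs_if split: if_splits)
      then have "g t * g s > 0" by (auto simp: abs_if zero_less_mult_iff split: if_splits)
      then show ?thesis using \<phi>(2)[OF True] by (simp add: mult.assoc)
    qed (use \<phi>(3) in simp)
    have "integral {0..1} (\<lambda>t. \<phi> t * g t * g s) = 0"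
      using int0 by simp
    moreover have "continuous_on {0..1} (\<lambda>t. \<phi> t * g t * g s)"
      by (intro continuous_intros g continuous_on_subset[OF \<phi>(1)]) auto
    ultimately have "\<phi> s * g s * g s = 0"
      using integral_eq_0_iff[of 0 1 "\<lambda>t. \<phi> t * g t * g s"] pos s by auto
    moreover have "\<phi> s > 0" using \<phi>(2)[of s] e by auto
    ultimately show False using nz by simp
  qed
  show ?thesis
    using continuous_constant_on_closure[of "{0<..<1::real}" g 0 s] g inner s by simp
qed

text \<open>\<open>grad\<close> is a definite description, so the Riesz representative of
  \<open>f'\<close> must first be shown to be the only gradient.\<close>

lemma grad_inner_eq:
  fixes f :: "'a::euclidean_space \<Rightarrow> real"
  assumes "(f has_derivative f') (at x)"
  shows "grad f x \<bullet> v = f' v"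
proof -
  interpret bounded_linear f' using assms by (rule has_derivative_bounded_linear)
  let ?D = "\<Sum>b\<in>Basis. f' b *\<^sub>R b"
  have D: "f' h = h \<bullet> ?D" for h
  proof -
    have "f' h = f' (\<Sum>b\<in>Basis. (h \<bullet> b) *\<^sub>R b)" by (simp add: euclidean_representation)
    also have "\<dots> = h \<bullet> ?D" by (simp add: sum scaleR inner_sum_right mult.commute)
    finally show ?thesis .
  qed
  then have "f' = (\<lambda>h. h \<bullet> ?D)" by blast
  then have "GDERIV f x :> ?D"
    using assms by (simp add: gderiv_def)
  moreover have "E = ?D" if "GDERIV f x :> E" for E
  proof -
    have "(\<lambda>h. h \<bullet> E) = f'"
      using has_derivative_unique[OF that[unfolded gderiv_def] assms] .
    then have "h \<bullet> E = h \<bullet> ?D" for h using D by metis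
    then show ?thesis by (metis inner_commute vector_eq_ldot)
  qed
  ultimately have "grad f x = ?D" unfolding grad_def by blast
  then show ?thesis using D[of v] by (simp add: inner_commute)
qed

subsection \<open>Functions whose Hessian annihilates the normal directions\<close>

lemma constant_along_ray:
  fixes g :: "'a::real_normed_vector \<Rightarrow> real"
  assumes "\<And>r. r > 0 \<Longrightarrow> (g has_derivative g' r) (at (r *\<^sub>R x))"
    and "\<And>r. r > 0 \<Longrightarrow> g' r x = 0" and "r > 0"
  shows "g (r *\<^sub>R x) = g x"
proof -
  have "((\<lambda>r. g (r *\<^sub>R x)) has_derivative (\<lambda>h. 0)) (at r within {0<..})" if "r \<in> {0<..}" for r
  proof -
    have "((\<lambda>r. g (r *\<^sub>R x)) has_derivative (\<lambda>h. g' r (h *\<^sub>R x))) (at r within {0<..})"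
    proof (rule has_derivative_compose[where f = "\<lambda>r. r *\<^sub>R x" and f' = "\<lambda>h. h *\<^sub>R x"])
      show "((\<lambda>r. r *\<^sub>R x) has_derivative (\<lambda>h. h *\<^sub>R x)) (at r within {0<..})"
        by (auto intro!: derivative_eq_intros)
      show "(g has_derivative g' r) (at (r *\<^sub>R x))" using that by (intro assms(1)) simp
    qed
    moreover have "g' r (h *\<^sub>R x) = 0" for h
      using assms(1,2)[of r] that
      by (simp add: linear_scale has_derivative_linear)
    ultimately show ?thesis by simp
  qed
  then have "(\<lambda>r. g (r *\<^sub>R x)) constant_on {0<..}"
    using has_derivative_zero_constant[of "{0<..}" "\<lambda>r. g (r *\<^sub>R x)"] 
    by (auto simp: constant_on_def)
  then have "g (r *\<^sub>R x) = g (1 *\<^sub>R x)" using \<open>r > 0\<close>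
    unfolding constant_on_def by (metis greaterThan_iff zero_less_one)
  then show ?thesis by simp
qed

text \<open>For orthogonal \<open>x\<close> and \<open>y\<close> of equal norm this is a circle
  about 0; its velocity \<open>rot y (- x)\<close> has the same form.\<close>

definition rot :: "'a::real_vector \<Rightarrow> 'a \<Rightarrow> real \<Rightarrow> 'a" where
  "rot x y t = cos t *\<^sub>R x + sin t *\<^sub>R y"

lemma rot_0 [simp]: "rot x y 0 = x"
  by (simp add: rot_def)

lemma has_vector_derivative_rot:
  "(rot x y has_vector_derivative rot y (- x) t) (at t within S)"
  unfolding rot_def by (auto intro!: derivative_eq_intros simp: algebra_simps)

lemma has_derivative_rot:
  "(rot x y has_derivative (\<lambda>h. h *\<^sub>R rot y (- x) t)) (at t within S)"
  using has_vector_derivative_rot unfolding has_vector_derivative_def .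

lemma rot_orthogonal:
  fixes x y :: "'a::real_inner"
  assumes "x \<bullet> y = 0" "x \<bullet> x = y \<bullet> y"
  shows "rot y (- x) t \<bullet> rot x y t = 0" "rot x y t \<bullet> rot x y t = x \<bullet> x"
proof -
  show "rot y (- x) t \<bullet> rot x y t = 0"
    using assms by (simp add: rot_def inner_simps inner_commute[of y x])
  have "rot x y t \<bullet> rot x y t = (cos t * cos t) * (x \<bullet> x) + (sin t * sin t) * (y \<bullet> y)"
    using assms(1) by (simp add: rot_def inner_simps inner_commute[of y x])
  also have "\<dots> = (cos t * cos t + sin t * sin t) * (x \<bullet> x)"
    using assms(2) by (simp only: distrib_right)
  finally show "rot x y t \<bullet> rot x y t = x \<bullet> x" by (simp only: sin_cos_squared_add3 mult_1)
qed

text \<open>\<open>H x w q\<close> differentiates \<open>f' _ w\<close> in direction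
  \<open>q\<close>. Symmetry in \<open>w\<close> and \<open>q\<close> is not assumed, and
  \<open>H_normal\<close> restricts only the slot \<open>w\<close>, so tangential \<open>q\<close>
  needs a separate argument.\<close>

locale normal_degenerate_hessian =
  fixes f :: "'a::euclidean_space \<Rightarrow> real" and f' :: "'a \<Rightarrow> 'a \<Rightarrow> real"
    and H :: "'a \<Rightarrow> 'a \<Rightarrow> 'a \<Rightarrow> real"
  assumes f': "x \<noteq> 0 \<Longrightarrow> (f has_derivative f' x) (at x)"
    and H: "x \<noteq> 0 \<Longrightarrow> ((\<lambda>y. f' y w) has_derivative H x w) (at x)"
    and H_normal: "x \<noteq> 0 \<Longrightarrow> w \<bullet> x = 0 \<Longrightarrow> H x w q = 0"
begin

lemma linear_f': "x \<noteq> 0 \<Longrightarrow> linear (f' x)"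
  using f' has_derivative_linear by blast

lemma linear_H: "x \<noteq> 0 \<Longrightarrow> linear (H x w)"
  using H has_derivative_linear by blast

text \<open>Linearity in \<open>w\<close> is inherited from \<open>f'\<close>, which is linear at
  every nonzero point and hence near \<open>x\<close>; uniqueness of derivatives transfers it to
  \<open>H\<close>.\<close>

lemma H_decompose:
  assumes "x \<noteq> 0" shows "H x (a *\<^sub>R v + b *\<^sub>R w) q = a * H x v q + b * H x w q"
proof -
  have "((\<lambda>y. a * f' y v + b * f' y w) has_derivative (\<lambda>q. a * H x v q + b * H x w q)) (at x)"
    by (intro derivative_intros H assms)
  then have "((\<lambda>y. f' y (a *\<^sub>R v + b *\<^sub>R w)) has_derivative (\<lambda>q. a * H x v q + b * H x w q)) (at x)"
    by (rule has_derivative_transform_within_open[where s = "- {0}"])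
      (use assms linear_f' in \<open>auto simp: linear_add linear_scale\<close>)
  from has_derivative_unique[OF this H[OF assms]] show ?thesis by (rule fun_cong[OF sym])
qed

context
  fixes x y :: 'a
  assumes x: "x \<noteq> 0" and xy: "x \<bullet> y = 0" "x \<bullet> x = y \<bullet> y"
begin

lemma rot_nz: "rot x y t \<noteq> 0"
  using rot_orthogonal(2)[OF xy, of t] x by auto

text \<open>The velocity of the circle is orthogonal to its position, so \<open>H_normal\<close>
  makes the tangential component of \<open>f'\<close> independent of the radius. Hence both sides
  have the same derivative in \<open>t\<close>, and both vanish at \<open>t = 0\<close>.\<close>

lemma f_rot_scaled:
  assumes "r > 0"
  shows "f (r *\<^sub>R rot x y t) - f (r *\<^sub>R x) = r * (f (rot x y t) - f x)"
proof -
  let ?g = "\<lambda>t. f (r *\<^sub>R rot x y t) - r * f (rot x y t)"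
  have "(?g has_real_derivative 0) (at t)" for t
  proof -
    let ?c = "rot x y t" and ?d = "rot y (- x) t"
    have "(?g has_derivative (\<lambda>h. f' (r *\<^sub>R ?c) (r *\<^sub>R h *\<^sub>R ?d) - r * f' ?c (h *\<^sub>R ?d))) (at t)"
      by (rule derivative_intros has_derivative_compose[OF _ f'] has_derivative_rot
          | use rot_nz assms in force)+
    moreover have "f' (r *\<^sub>R ?c) ?d = f' ?c ?d"
      by (rule constant_along_ray[where g' = "\<lambda>r. H (r *\<^sub>R ?c) ?d"])
        (use rot_nz assms in \<open>auto intro!: H H_normal simp: rot_orthogonal[OF xy]\<close>)
    ultimately have "(?g has_derivative (\<lambda>h. 0)) (at t)"
      using assms rot_nz[of t] by (simp add: linear_scale linear_f' algebra_simps)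
    then show ?thesis by (simp add: has_field_derivative_def fun_eq_iff lambda_zero)
  qed
  then have "?g t = ?g 0" by (intro DERIV_isconst_all allI)
  then show ?thesis by (simp add: algebra_simps)
qed

text \<open>This is the \<open>r\<close>-derivative of \<open>f_rot_scaled\<close> at
  \<open>r = 1\<close>.\<close>

lemma radial_identity:
  "f' (rot x y t) (rot x y t) - f (rot x y t) = f' x x - f x"
proof -
  let ?c = "rot x y t"
  have "((\<lambda>r. f (r *\<^sub>R ?c) - f (r *\<^sub>R x) - r * (f ?c - f x)) has_derivative
      (\<lambda>h. f' (1 *\<^sub>R ?c) (h *\<^sub>R ?c) - f' (1 *\<^sub>R x) (h *\<^sub>R x) - h * (f ?c - f x))) (at 1)"
    by (rule derivative_intros has_derivative_compose[OF _ f'] | use rot_nz x in force)+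
  moreover have "((\<lambda>r. f (r *\<^sub>R ?c) - f (r *\<^sub>R x) - r * (f ?c - f x)) has_derivative (\<lambda>h. 0)) (at 1)"
    by (rule has_derivative_transform_within_open[where s = "{0<..}", OF has_derivative_const[of 0]])
      (auto simp: f_rot_scaled)
  ultimately have "(\<lambda>h. f' (1 *\<^sub>R ?c) (h *\<^sub>R ?c) - f' (1 *\<^sub>R x) (h *\<^sub>R x) - h * (f ?c - f x)) = (\<lambda>h. 0)"
    by (rule has_derivative_unique)
  from fun_cong[OF this, of 1] show ?thesis by simp
qed

text \<open>
  Symmetry of the Hessian, obtained without Schwarz's theorem (which the library lacks) by
  differentiating the radial identity along the circle.
\<close>

lemma H_radial_tangential: "H x x y = 0"
proof -
  \<comment> \<open>Expanding the second argument of \<open>f'\<close> leaves only the fixed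
    directions \<open>x\<close> and \<open>y\<close>, for which \<open>H\<close> gives the
    derivative. At \<open>t = 0\<close> the two terms \<open>f' x y\<close> cancel and
    \<open>H x x y\<close> remains.\<close>
  let ?g = "\<lambda>t. cos t * f' (rot x y t) x + sin t * f' (rot x y t) y - f (rot x y t)"
  have "?g t = f' x x - f x" for t
    using radial_identity[of t] linear_f'[OF rot_nz, of t]
    by (subst (asm) (2) rot_def) (simp add: linear_add linear_scale)
  then have "(?g has_derivative (\<lambda>h. 0)) (at 0)" by simp
  moreover have "(?g has_derivative (\<lambda>h. (cos 0 * H (rot x y 0) x (h *\<^sub>R rot y (- x) 0) + h * (- sin 0) * f' (rot x y 0) x)
      + (sin 0 * H (rot x y 0) y (h *\<^sub>R rot y (- x) 0) + h * cos 0 * f' (rot x y 0) y) - f' (rot x y 0) (h *\<^sub>R rot y (- x) 0))) (at 0)"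
    by (rule derivative_intros has_derivative_compose[OF _ f'] has_derivative_compose[OF _ H]
        has_derivative_rot rot_nz has_field_derivative_imp_has_derivative DERIV_sin DERIV_cos| force)+
  ultimately have "(\<lambda>h. 0) = (\<lambda>h. (cos 0 * H (rot x y 0) x (h *\<^sub>R rot y (- x) 0) + h * (- sin 0) * f' (rot x y 0) x)
      + (sin 0 * H (rot x y 0) y (h *\<^sub>R rot y (- x) 0) + h * cos 0 * f' (rot x y 0) y) - f' (rot x y 0) (h *\<^sub>R rot y (- x) 0))"
    by (rule has_derivative_unique)
  from fun_cong[OF this, of 1] show ?thesis by simp
qed

end

text \<open>The part of \<open>w\<close> orthogonal to \<open>x\<close> falls to
  \<open>H_normal\<close>, the radial part to \<open>H_radial_tangential\<close> once
  \<open>q\<close> is rescaled to the length of \<open>x\<close>.\<close>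

lemma H_tangential:
  assumes "x \<noteq> 0" "q \<bullet> x = 0" shows "H x w q = 0"
proof -
  have rad: "H x x q = 0"
  proof (cases "q = 0")
    case True
    then show ?thesis using linear_H[OF assms(1)] by (simp add: linear_0)
  next
    case False
    let ?k = "norm x / norm q"
    have "H x x (?k *\<^sub>R q) = 0"
      by (rule H_radial_tangential)
        (use assms False in \<open>auto simp: inner_commute dot_square_norm power2_eq_square\<close>)
    then show ?thesis using linear_H[OF assms(1)] False assms(1) by (simp add: linear_scale)
  qed
  let ?a = "(w \<bullet> x) / (x \<bullet> x)"
  have "H x w q = H x (?a *\<^sub>R x + 1 *\<^sub>R (w - ?a *\<^sub>R x)) q" by simp
  also have "\<dots> = ?a * H x x q + 1 * H x (w - ?a *\<^sub>R x) q"
    by (rule H_decompose[OF assms(1)])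
  also have "H x (w - ?a *\<^sub>R x) q = 0"
    by (rule H_normal) (use assms in \<open>auto simp: inner_simps\<close>)
  finally show ?thesis using rad by simp
qed

text \<open>
  The derivative of \<open>f\<close> is constant along circles about \<open>0\<close>, and its \<open>x\<close>-component is constant along
  rays orthogonal to \<open>x\<close>; a quarter turn transports the latter to the ray through \<open>x\<close>.
\<close>

lemma H_radial:
  assumes dim: "DIM('a) > 1" and x: "x \<noteq> 0"
  shows "H x x x = 0"
proof -
  \<comment> \<open>Dimension above 1 supplies the second ray; rescaling to the length of
    \<open>x\<close> puts \<open>x\<close> and \<open>y\<close> on one circle.\<close>
  obtain z where z: "z \<noteq> 0" "orthogonal x z"
    using orthogonal_to_vector_exists[of x] dim by auto
  define y where "y = (norm x / norm z) *\<^sub>R z"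
  have y: "y \<noteq> 0" "x \<bullet> y = 0" "x \<bullet> x = y \<bullet> y"
    using z x by (auto simp: y_def orthogonal_def dot_square_norm power2_eq_square)
  have eq: "f' (r *\<^sub>R x) x = f' y x" if r: "r > 0" for r
  proof -
    let ?c = "rot (r *\<^sub>R x) (r *\<^sub>R y)" and ?d = "rot (r *\<^sub>R y) (- (r *\<^sub>R x))"
    have xy: "(r *\<^sub>R x) \<bullet> (r *\<^sub>R y) = 0" "(r *\<^sub>R x) \<bullet> (r *\<^sub>R x) = (r *\<^sub>R y) \<bullet> (r *\<^sub>R y)" "r *\<^sub>R x \<noteq> 0"
      using y r x by auto
    have "((\<lambda>t. f' (?c t) x) has_real_derivative 0) (at t)" for t
    proof -
      have nz: "?c t \<noteq> 0" using rot_nz[OF xy(3,1,2)] .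
      have "((\<lambda>t. f' (?c t) x) has_derivative (\<lambda>h. H (?c t) x (h *\<^sub>R ?d t))) (at t)"
        by (rule has_derivative_compose[OF has_derivative_rot H[OF nz]])
      moreover have "H (?c t) x (h *\<^sub>R ?d t) = 0" for h
        by (rule H_tangential[OF nz]) (simp add: rot_orthogonal[OF xy(1,2)])
      ultimately show ?thesis by (simp add: has_field_derivative_def lambda_zero)
    qed
    then have "f' (?c (pi / 2)) x = f' (?c 0) x"
      by (intro DERIV_isconst_all allI)
    then have "f' (r *\<^sub>R x) x = f' (r *\<^sub>R y) x" by (simp add: rot_def)
    also have "\<dots> = f' y x"
      by (rule constant_along_ray[where g' = "\<lambda>r. H (r *\<^sub>R y) x"])
        (use r y in \<open>auto intro!: H H_normal\<close>)
    finally show ?thesis .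
  qed
  have "((\<lambda>r. f' (r *\<^sub>R x) x) has_derivative (\<lambda>h. H (1 *\<^sub>R x) x (h *\<^sub>R x))) (at 1)"
    by (rule has_derivative_compose[OF _ H]) (use x in \<open>auto intro!: derivative_eq_intros\<close>)
  moreover have "((\<lambda>r. f' (r *\<^sub>R x) x) has_derivative (\<lambda>h. 0)) (at 1)"
    by (rule has_derivative_transform_within_open[where s = "{0<..}", OF has_derivative_const[of "f' y x"]])
      (auto simp: eq)
  ultimately have "(\<lambda>h. H (1 *\<^sub>R x) x (h *\<^sub>R x)) = (\<lambda>h. 0)" by (rule has_derivative_unique)
  from fun_cong[OF this, of 1] show ?thesis by simp
qed

text \<open>Removing the non-radial component in each slot reduces every value to a multiple of
  \<open>H x x x\<close>.\<close>

lemma H_zero: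
  assumes dim: "DIM('a) > 1" and x: "x \<noteq> 0"
  shows "H x w q = 0"
proof -
  let ?a = "(w \<bullet> x) / (x \<bullet> x)" and ?b = "(q \<bullet> x) / (x \<bullet> x)"
  have q: "H x v q = ?b * H x v x" for v
  proof -
    have "H x v (q - ?b *\<^sub>R x) = 0"
      by (rule H_tangential) (use x in \<open>auto simp: inner_simps\<close>)
    then show ?thesis using linear_H[OF x] by (simp add: linear_diff linear_scale)
  qed
  have "H x w x = H x (?a *\<^sub>R x + 1 *\<^sub>R (w - ?a *\<^sub>R x)) x" by simp
  also have "\<dots> = ?a * H x x x + 1 * H x (w - ?a *\<^sub>R x) x"
    by (rule H_decompose[OF x])
  also have "H x (w - ?a *\<^sub>R x) x = 0"
    by (rule H_normal) (use x in \<open>auto simp: inner_simps\<close>)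
  finally show ?thesis using q[of w] H_radial[OF dim x] by simp
qed

text \<open>This ball is convex and avoids 0, so a zero derivative forces constancy: first of
  \<open>f'\<close>, then of \<open>f\<close> minus the linear map \<open>f' p0\<close>.\<close>

lemma affine_on_ball:
  assumes dim: "DIM('a) > 1" and p0: "p0 \<noteq> 0" and p: "p \<in> ball p0 (norm p0)"
  shows "f p = f p0 + f' p0 (p - p0)"
proof -
  let ?B = "ball p0 (norm p0)"
  have nz: "x \<noteq> 0" if "x \<in> ?B" for x using that by auto
  have const: "f' x w = f' p0 w" if "x \<in> ?B" for x w
  proof -
    have "((\<lambda>y. f' y w) has_derivative (\<lambda>h. 0)) (at x within ?B)" if "x \<in> ?B" for x
    proof -
      have "H x w = (\<lambda>h. 0)" using H_zero[OF dim nz[OF that]] by blast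
      then show ?thesis using has_derivative_at_withinI[OF H[OF nz[OF that], of w]] by simp
    qed
    then show ?thesis
      using has_derivative_zero_unique[of ?B "\<lambda>y. f' y w" x p0] that p0 by auto
  qed
  let ?g = "\<lambda>x. f x - f' p0 x"
  have "(?g has_derivative (\<lambda>h. 0)) (at x within ?B)" if "x \<in> ?B" for x
  proof -
    have "(?g has_derivative (\<lambda>h. f' x h - f' p0 h)) (at x within ?B)"
      by (intro derivative_intros has_derivative_at_withinI[OF f'] nz that
          bounded_linear.has_derivative[OF has_derivative_bounded_linear[OF f'[OF p0]], of "\<lambda>x. x"])
    then show ?thesis using const[OF that] by simp
  qed
  then have "?g p = ?g p0"
    using has_derivative_zero_unique[of ?B ?g p p0] p p0 by auto
  then show ?thesis using linear_f'[OF p0] by (simp add: linear_diff)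
qed

end

subsection \<open>Normal variations of quadratic curves\<close>

text \<open>\<open>Ck_on\<close> yields continuity only for fixed directions. A direction moving
  along a line is reduced by linearity to the fixed ones \<open>c\<close> and
  \<open>d\<close>.\<close>

lemma continuous_on_affine_direction:
  fixes A :: "'a::topological_space \<Rightarrow> 'b::real_normed_vector \<Rightarrow> real"
  assumes A: "\<And>v. continuous_on S (\<lambda>s. A s v)" and lin: "\<And>s. s \<in> S \<Longrightarrow> linear (A s)"
    and m: "continuous_on S m" and B: "\<And>s. s \<in> S \<Longrightarrow> B s = c + m s *\<^sub>R d"
  shows "continuous_on S (\<lambda>s. A s (B s))"
proof -
  have "continuous_on S (\<lambda>s. A s c + m s * A s d)"
    by (intro continuous_intros A m)
  then show ?thesis
    by (rule continuous_on_eq) (simp add: B lin linear_add linear_scale)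
qed

locale lagrangian_jet =
  fixes L :: "real \<Rightarrow> real ^ 'n \<Rightarrow> real ^ 'n \<Rightarrow> real"
    and DL :: "real \<times> (real ^ 'n) \<times> (real ^ 'n) \<Rightarrow> real \<times> (real ^ 'n) \<times> (real ^ 'n) \<Rightarrow> real"
    and D2L :: "real \<times> (real ^ 'n) \<times> (real ^ 'n) \<Rightarrow> real \<times> (real ^ 'n) \<times> (real ^ 'n) \<Rightarrow>
      real \<times> (real ^ 'n) \<times> (real ^ 'n) \<Rightarrow> real"
  assumes DL: "x \<in> lagrangian_domain \<Longrightarrow>
      ((\<lambda>(s, u, p). L s u p) has_derivative DL x) (at x within lagrangian_domain)"
    and D2L: "x \<in> lagrangian_domain \<Longrightarrow>
      ((\<lambda>x. DL x v) has_derivative D2L x v) (at x within lagrangian_domain)"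
    and continuous_on_D2L: "continuous_on lagrangian_domain (\<lambda>x. D2L x v w)"
begin

lemma linear_DL: "x \<in> lagrangian_domain \<Longrightarrow> linear (DL x)"
  by (rule has_derivative_linear[OF DL])

lemma linear_D2L: "x \<in> lagrangian_domain \<Longrightarrow> linear (D2L x v)"
  by (rule has_derivative_linear[OF D2L])

lemma continuous_on_DL: "continuous_on lagrangian_domain (\<lambda>x. DL x v)"
  unfolding continuous_on_eq_continuous_within using has_derivative_continuous[OF D2L] by blast

lemma has_derivative_L_u:
  assumes "s \<in> {0..1}" "p \<noteq> 0"
  shows "((\<lambda>w. L s w p) has_derivative (\<lambda>h. DL (s, u, p) (0, h, 0))) (at u)"
proof -
  have "((\<lambda>w. (s, w, p)) has_derivative (\<lambda>h. (0, h, 0))) (at u)"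
    by (intro derivative_intros)
  moreover have "range (\<lambda>w. (s, w, p)) \<subseteq> lagrangian_domain"
    using assms by (auto simp: lagrangian_domain_def)
  ultimately show ?thesis
    using has_derivative_in_compose2[of lagrangian_domain "\<lambda>(s, u, p). L s u p" DL "\<lambda>w. (s, w, p)" UNIV] DL
    by fastforce
qed

text \<open>The domain is closed in \<open>s\<close>, but its \<open>p\<close>-slices are open, so
  on them the derivative within the domain becomes a full one. A general \<open>F\<close> covers
  both \<open>L\<close> and the functions \<open>DL _ v\<close>.\<close>

lemma has_derivative_p_slice:
  assumes F: "\<And>x. x \<in> lagrangian_domain \<Longrightarrow> (F has_derivative F' x) (at x within lagrangian_domain)"
    and "s \<in> {0..1}" "p \<noteq> 0"
  shows "((\<lambda>q. F (s, u, q)) has_derivative (\<lambda>h. F' (s, u, p) (0, 0, h))) (at p)"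
proof -
  have "((\<lambda>q. (s, u, q)) has_derivative (\<lambda>h. (0, 0, h))) (at p within - {0})"
    by (intro derivative_intros)
  moreover have "(\<lambda>q. (s, u, q)) ` (- {0}) \<subseteq> lagrangian_domain"
    using assms by (auto simp: lagrangian_domain_def)
  ultimately have "((\<lambda>q. F (s, u, q)) has_derivative (\<lambda>h. F' (s, u, p) (0, 0, h))) (at p within - {0})"
    using has_derivative_in_compose2[of lagrangian_domain F F' "\<lambda>q. (s, u, q)" "- {0}" p] F assms(3)
    by blast
  moreover have "at p within - {0} = at p"
    by (rule at_within_open) (use assms(3) in auto)
  ultimately show ?thesis by simp
qed

lemma has_derivative_L_p:
  assumes "s \<in> {0..1}" "p \<noteq> 0"
  shows "(L s u has_derivative (\<lambda>h. DL (s, u, p) (0, 0, h))) (at p)"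
  using has_derivative_p_slice[OF DL assms] by simp

lemma first_variation_eq:
  assumes "\<And>s. s \<in> {0..1} \<Longrightarrow> deriv01 u s = p s" "\<And>s. s \<in> {0..1} \<Longrightarrow> p s \<noteq> 0"
    and "\<And>s. s \<in> {0..1} \<Longrightarrow> deriv01 v s = v' s"
  shows "first_variation L u v =
    integral {0..1} (\<lambda>s. DL (s, u s, p s) (0, v s, 0) + DL (s, u s, p s) (0, 0, v' s))"
  unfolding first_variation_def
  by (rule integral_cong)
    (use assms in \<open>simp add: grad_inner_eq[OF has_derivative_L_u] grad_inner_eq[OF has_derivative_L_p]\<close>)

section \<open>The Euler-Lagrange identity along a quadratic curve\<close>

context
  fixes s0 :: real and u0 p0 q :: "real ^ 'n" and J :: "real ^ 'n \<Rightarrow> real ^ 'n"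
  assumes N: "N_lagrangian L" and s0: "s0 \<in> {0..1}" and q: "norm q < norm p0"
    and J: "bounded_linear J" and skew: "\<And>x. J x \<bullet> x = 0"
begin

definition "vel s = p0 + (s - s0) *\<^sub>R q"
definition "pos s = u0 + (s - s0) *\<^sub>R p0 + ((s - s0)\<^sup>2 / 2) *\<^sub>R q"
definition "jet s = (s, pos s, vel s)"

text \<open>On \<open>{0..1}\<close> the parameter stays within distance 1 of \<open>s0\<close>, so
  the bound on \<open>q\<close> keeps the second term too short to cancel \<open>p0\<close>.
  Membership in \<open>C2_R\<close> asks for this on the whole interval.\<close>

lemma vel_nz: "s \<in> {0..1} \<Longrightarrow> vel s \<noteq> 0"
proof
  assume s: "s \<in> {0..1}" and "vel s = 0"
  then have "p0 = - ((s - s0) *\<^sub>R q)" by (simp add: vel_def eq_neg_iff_add_eq_0)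
  then have "norm p0 = \<bar>s - s0\<bar> * norm q" by simp
  also have "\<dots> \<le> 1 * norm q" using s s0 by (intro mult_right_mono) auto
  finally show False using q by simp
qed

lemma jet_in_domain: "s \<in> {0..1} \<Longrightarrow> jet s \<in> lagrangian_domain"
  using vel_nz by (auto simp: jet_def lagrangian_domain_def)

lemma vel_derivative: "(vel has_vector_derivative q) (at s within S)"
  unfolding vel_def by (auto intro!: derivative_eq_intros)

lemma pos_derivative: "(pos has_vector_derivative vel s) (at s within S)"
  unfolding pos_def vel_def by (auto intro!: derivative_eq_intros)

lemma jet_derivative: "(jet has_derivative (\<lambda>h. h *\<^sub>R (1, vel s, q))) (at s within S)"
  using has_derivative_Pair[OF has_derivative_ident has_derivative_Pair[OF
      pos_derivative[unfolded has_vector_derivative_def] vel_derivative[unfolded has_vector_derivative_def]]]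
  by (simp add: jet_def[abs_def])

lemma continuous_on_jet: "continuous_on S jet"
  using jet_derivative has_derivative_continuous by (fastforce simp: continuous_on_eq_continuous_within)

lemma J_vel: "J (vel s) = J p0 + (s - s0) *\<^sub>R J q"
  using J by (simp add: vel_def linear_simps)

lemma continuous_on_DL_jet: "continuous_on {0..1} (\<lambda>s. DL (jet s) v)"
  by (rule continuous_on_compose2[OF continuous_on_DL continuous_on_jet]) (use jet_in_domain in auto)

lemma continuous_on_D2L_jet: "continuous_on {0..1} (\<lambda>s. D2L (jet s) v w)"
  by (rule continuous_on_compose2[OF continuous_on_D2L continuous_on_jet]) (use jet_in_domain in auto)

lemma DL_jet_derivative:
  assumes "s \<in> {0..1}"
  shows "((\<lambda>s. DL (jet s) v) has_real_derivative D2L (jet s) v (1, vel s, q)) (at s within {0..1})"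
proof -
  have "((\<lambda>s. DL (jet s) v) has_derivative (\<lambda>h. D2L (jet s) v (h *\<^sub>R (1, vel s, q)))) (at s within {0..1})"
    using has_derivative_in_compose2[of lagrangian_domain "\<lambda>x. DL x v" "\<lambda>x. D2L x v" jet "{0..1}" s]
      D2L jet_in_domain jet_derivative assms by blast
  moreover have "D2L (jet s) v (h *\<^sub>R (1, vel s, q)) = D2L (jet s) v (1, vel s, q) * h" for h
    by (simp only: linear_scale[OF linear_D2L[OF jet_in_domain[OF assms]]] real_scaleR_def mult.commute)
  ultimately show ?thesis by (simp add: has_field_derivative_def)
qed

lemma pos_in_C2_R: "pos \<in> C2_R" and deriv01_pos: "s \<in> {0..1} \<Longrightarrow> deriv01 pos s = vel s"
proof -
  show d: "deriv01 pos s = vel s" if "s \<in> {0..1}" for s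
    by (rule vector_derivative_within_closed_interval[OF zero_less_one that pos_derivative])
  have "Ck_on k S pos" for k S
  proof -
    have "Ck_on k S (\<lambda>s. u0 + (s + - s0) *\<^sub>R p0 + ((s + - s0) *\<^sub>R (s + - s0) *\<^sub>R (1 / 2)) *\<^sub>R q)"
      by (intro Ck_on_add Ck_on_scaleR Ck_on_const Ck_on_ident)
    then show ?thesis by (rule Ck_on_cong) (simp add: pos_def power2_eq_square)
  qed
  then show "pos \<in> C2_R" using d vel_nz by (simp add: C2_R_def)
qed

text \<open>The total derivative along the curve of \<open>L_p\<close> paired with
  \<open>J (vel s)\<close>, expanded by \<open>J_vel\<close> into fixed directions.\<close>

definition "slope s = D2L (jet s) (0, 0, J p0) (1, vel s, q)
  + (DL (jet s) (0, 0, J q) + (s - s0) * D2L (jet s) (0, 0, J q) (1, vel s, q))"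

lemma DL_J_vel_derivative:
  assumes "s \<in> {0..1}"
  shows "((\<lambda>s. DL (jet s) (0, 0, J (vel s))) has_real_derivative slope s) (at s within {0..1})"
proof -
  have deriv: "((\<lambda>s. DL (jet s) (0, 0, J p0) + (s - s0) * DL (jet s) (0, 0, J q)) has_real_derivative slope s)
      (at s within {0..1})"
    by (rule DERIV_cong, (rule derivative_intros DL_jet_derivative assms)+) (simp add: slope_def algebra_simps)
  have eq: "DL (jet s) (0, 0, J p0) + (s - s0) * DL (jet s) (0, 0, J q) = DL (jet s) (0, 0, J (vel s))"
    if "s \<in> {0..1}" for s
  proof -
    note lin = linear_DL[OF jet_in_domain[OF that]]
    have "DL (jet s) (0, 0, J (vel s)) = DL (jet s) ((0, 0, J p0) + (s - s0) *\<^sub>R (0, 0, J q))"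
      by (simp add: J_vel)
    then show ?thesis by (simp only: linear_add[OF lin] linear_scale[OF lin] real_scaleR_def)
  qed
  show ?thesis
    using deriv unfolding has_field_derivative_def
    by (rule has_derivative_transform[OF assms, rotated]) (simp add: eq)
qed

lemma slope_continuous: "continuous_on {0..1} slope"
proof -
  have "continuous_on {0..1} (\<lambda>s. D2L (jet s) v (1, vel s, q))" for v
    by (rule continuous_on_affine_direction[where m = "\<lambda>s. s - s0" and c = "(1, p0, q)" and d = "(0, q, 0)"])
      (auto intro!: continuous_on_D2L_jet linear_D2L jet_in_domain continuous_intros simp: vel_def)
  then show ?thesis
    unfolding slope_def by (intro continuous_intros continuous_on_DL_jet)
qed

text \<open>The coefficient of the undifferentiated bump in the first variation; the second term
  comes from differentiating \<open>J (vel s)\<close>.\<close>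

definition "force s = DL (jet s) (0, J (vel s), 0) + DL (jet s) (0, 0, J q)"

lemma force_continuous: "continuous_on {0..1} force"
proof -
  have "continuous_on {0..1} (\<lambda>s. DL (jet s) (0, J (vel s), 0))"
    by (rule continuous_on_affine_direction[where m = "\<lambda>s. s - s0" and c = "(0, J p0, 0)" and d = "(0, J q, 0)"])
      (auto intro!: continuous_on_DL_jet linear_DL jet_in_domain continuous_intros simp: J_vel)
  then show ?thesis
    unfolding force_def by (intro continuous_intros continuous_on_DL_jet)
qed

text \<open>For the variation \<open>\<phi> s *\<^sub>R J (vel s)\<close> the integrand differs from
  \<open>\<phi> s * (force s - slope s)\<close> by an exact derivative, which integrates to zero
  because \<phi> vanishes at 0 and 1.\<close>

lemma euler_lagrange_weak:
  fixes \<phi> \<phi>' :: "real \<Rightarrow> real"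
  assumes smooth: "\<And>k. Ck_on k {0..1} \<phi>"
    and \<phi>': "\<And>x. (\<phi> has_real_derivative \<phi>' x) (at x)" "continuous_on UNIV \<phi>'"
    and ab: "0 < a" "b < 1" and supp: "\<And>x. x \<notin> {a<..<b} \<Longrightarrow> \<phi> x = 0"
  shows "integral {0..1} (\<lambda>s. \<phi> s * (force s - slope s)) = 0"
proof -
  let ?g = "\<lambda>s. DL (jet s) (0, 0, J (vel s))"
  txt \<open>Skewness of \<open>J\<close> makes this variation normal to the curve.\<close>
  let ?v = "\<lambda>s. \<phi> s *\<^sub>R J (vel s)" and ?v' = "\<lambda>s. \<phi> s *\<^sub>R J q + \<phi>' s *\<^sub>R J (vel s)"
  have v': "(?v has_vector_derivative ?v' s) (at s within {0..1})" for s
    by (intro has_vector_derivative_scaleR bounded_linear.has_vector_derivative[OF J] vel_derivative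
        DERIV_subset[OF \<phi>'(1)]) auto
  then have dv: "deriv01 ?v s = ?v' s" if "s \<in> {0..1}" for s
    by (intro vector_derivative_within_closed_interval[OF zero_less_one that])
  have "Ck_on k {0..1} ?v" for k
  proof -
    have "Ck_on k {0..1} (\<lambda>s. \<phi> s *\<^sub>R (J p0 + (s + - s0) *\<^sub>R J q))"
      by (intro Ck_on_add Ck_on_scaleR Ck_on_const Ck_on_ident smooth)
    then show ?thesis by (rule Ck_on_cong) (simp add: J_vel)
  qed
  \<comment> \<open>Since \<open>a\<close> and \<open>b\<close> lie strictly inside the unit
    interval, even the closure of the support avoids its end points, as \<open>Cinf_c\<close>
    demands.\<close>
  moreover have "closure (support_on {0..1} ?v) \<subseteq> {a..b}"
  proof (rule closure_minimal)
    show "support_on {0..1} ?v \<subseteq> {a..b}"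
    proof
      fix s assume "s \<in> support_on {0..1} ?v"
      then have "\<phi> s \<noteq> 0" by (auto simp: support_on_def)
      then have "s \<in> {a<..<b}" using supp by blast
      then show "s \<in> {a..b}" by simp
    qed
  qed simp
  ultimately have "?v \<in> normal_variations pos"
    using ab by (auto simp: normal_variations_def Cinf_c_def smooth_on_def deriv01_pos skew)
  then have "first_variation L pos ?v = 0"
    using N pos_in_C2_R by (auto simp: N_lagrangian_def)
  also have "first_variation L pos ?v =
      integral {0..1} (\<lambda>s. DL (jet s) (0, ?v s, 0) + DL (jet s) (0, 0, ?v' s))"
    unfolding jet_def by (rule first_variation_eq) (use dv deriv01_pos vel_nz in auto)
  also have "\<dots> = integral {0..1} (\<lambda>s. \<phi> s * (force s - slope s) + (\<phi> s * slope s + \<phi>' s * ?g s))"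
  proof (rule integral_cong)
    fix s :: real assume "s \<in> {0..1}"
    note lin = linear_DL[OF jet_in_domain[OF this]]
    have "DL (jet s) (0, ?v s, 0) = DL (jet s) (\<phi> s *\<^sub>R (0, J (vel s), 0))" by simp
    moreover have "DL (jet s) (0, 0, ?v' s) = DL (jet s) (\<phi> s *\<^sub>R (0, 0, J q) + \<phi>' s *\<^sub>R (0, 0, J (vel s)))" by simp
    ultimately show "DL (jet s) (0, ?v s, 0) + DL (jet s) (0, 0, ?v' s) =
        \<phi> s * (force s - slope s) + (\<phi> s * slope s + \<phi>' s * ?g s)"
      by (simp only: linear_add[OF lin] linear_scale[OF lin] real_scaleR_def force_def algebra_simps)
  qed
  finally have int: "integral {0..1} (\<lambda>s. \<phi> s * (force s - slope s) + (\<phi> s * slope s + \<phi>' s * ?g s)) = 0" .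
  have "((\<lambda>s. \<phi> s * ?g s) has_real_derivative \<phi> s * slope s + \<phi>' s * ?g s) (at s within {0..1})"
    if "s \<in> {0..1}" for s
    by (rule DERIV_cong[OF DERIV_mult[OF DERIV_subset[OF \<phi>'(1)] DL_J_vel_derivative[OF that]]]) auto
  then have "((\<lambda>s. \<phi> s * slope s + \<phi>' s * ?g s) has_integral (\<phi> 1 * ?g 1 - \<phi> 0 * ?g 0)) {0..1}"
    by (intro fundamental_theorem_of_calculus) (auto simp: has_real_derivative_iff_has_vector_derivative)
  moreover have "\<phi> 1 = 0" "\<phi> 0 = 0" using ab supp by auto
  ultimately have parts: "((\<lambda>s. \<phi> s * slope s + \<phi>' s * ?g s) has_integral 0) {0..1}" by simp
  have "continuous_on {0..1} \<phi>" using smooth[of 0] by simp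
  then have "(\<lambda>s. \<phi> s * (force s - slope s)) integrable_on {0..1}"
    by (intro integrable_continuous_interval continuous_intros force_continuous slope_continuous)
  then show ?thesis
    using int parts by (simp add: integral_add has_integral_integrable integral_unique)
qed

lemma euler_lagrange_normal:
  "DL (s0, u0, p0) (0, J p0, 0) = D2L (s0, u0, p0) (0, 0, J p0) (1, p0, q)"
proof -
  have "force s0 - slope s0 = 0"
  proof (rule fundamental_lemma_variations[where g = "\<lambda>s. force s - slope s"])
    show "continuous_on {0..1} (\<lambda>s. force s - slope s)"
      by (intro continuous_intros force_continuous slope_continuous)
    fix a b :: real assume ab: "0 < a" "a < b" "b < 1"
    obtain \<phi> \<phi>' :: "real \<Rightarrow> real" where \<phi>: "\<And>k S. Ck_on k S \<phi>"
      "\<And>x. (\<phi> has_real_derivative \<phi>' x) (at x)" "continuous_on UNIV \<phi>'"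
      "\<And>x. x \<in> {a<..<b} \<Longrightarrow> \<phi> x > 0" "\<And>x. x \<notin> {a<..<b} \<Longrightarrow> \<phi> x = 0"
      using smooth_bump_exists[OF ab(2)] by metis
    show "\<exists>\<phi>. continuous_on UNIV \<phi> \<and> (\<forall>x\<in>{a<..<b}. \<phi> x > (0::real)) \<and> (\<forall>x. x \<notin> {a<..<b} \<longrightarrow> \<phi> x = 0) \<and>
        integral {0..1} (\<lambda>s. \<phi> s * (force s - slope s)) = 0"
      using \<phi>(1)[of 0 UNIV] \<phi>(4,5) euler_lagrange_weak[OF \<phi>(1,2,3) ab(1,3) \<phi>(5)]
      by (intro exI[of _ \<phi>]) auto
  qed (use s0 in auto)
  \<comment> \<open>At \<open>s0\<close> the factor \<open>s - s0\<close> vanishes, and the term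
    \<open>DL (jet s) (0, 0, J q)\<close> cancels between \<open>force\<close> and
    \<open>slope\<close>.\<close>
  then show ?thesis by (simp add: force_def slope_def jet_def vel_def pos_def)
qed

end

text \<open>The left side of \<open>euler_lagrange_normal\<close> is free of \<open>q\<close>, so
  its right side agrees for small \<open>q\<close> and for 0; by linearity the difference is the
  Hessian term.\<close>

lemma hessian_skew:
  assumes N: "N_lagrangian L" and s: "s \<in> {0..1}" and p: "p \<noteq> 0"
    and J: "bounded_linear J" "\<And>x. J x \<bullet> x = 0"
  shows "D2L (s, u, p) (0, 0, J p) (0, 0, q) = 0"
proof -
  let ?B = "D2L (s, u, p) (0, 0, J p)"
  have lin: "linear ?B"
    using s p by (intro linear_D2L) (auto simp: lagrangian_domain_def)
  \<comment> \<open>Shrinking \<open>q\<close> meets the bound imposed on quadratic curves; the 1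
    added in the denominator covers \<open>q = 0\<close>.\<close>
  obtain c :: real where c: "c > 0" "norm (c *\<^sub>R q) < norm p"
  proof
    show "norm p / (norm q + 1) > 0" using p by (simp add: add_nonneg_pos)
    have "norm ((norm p / (norm q + 1)) *\<^sub>R q) = norm p * (norm q / (norm q + 1))" by simp
    also have "\<dots> < norm p * 1"
      by (rule mult_strict_left_mono) (use p in \<open>simp_all add: divide_less_eq add_nonneg_pos\<close>)
    finally show "norm ((norm p / (norm q + 1)) *\<^sub>R q) < norm p" by simp
  qed
  have "?B (1, p, c *\<^sub>R q) = ?B (1, p, 0)"
    using euler_lagrange_normal[OF N s c(2) J, of u] euler_lagrange_normal[OF N s _ J, of 0 p u] p by simp
  moreover have "?B (1, p, c *\<^sub>R q) = ?B ((1, p, 0) + c *\<^sub>R (0, 0, q))" by simp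
  ultimately have "c * ?B (0, 0, q) = 0"
    by (simp only: linear_add[OF lin] linear_scale[OF lin] real_scaleR_def)
  then show ?thesis using c by simp
qed

lemma slice_normal_degenerate_hessian:
  assumes N: "N_lagrangian L" and s: "s \<in> {0..1}"
  shows "normal_degenerate_hessian (L s u) (\<lambda>p w. DL (s, u, p) (0, 0, w))
    (\<lambda>p w q. D2L (s, u, p) (0, 0, w) (0, 0, q))"
proof
  fix p w q :: "real ^ 'n" assume p: "p \<noteq> 0"
  show "(L s u has_derivative (\<lambda>w. DL (s, u, p) (0, 0, w))) (at p)"
    by (rule has_derivative_L_p[OF s p])
  show "((\<lambda>y. DL (s, u, y) (0, 0, w)) has_derivative (\<lambda>q. D2L (s, u, p) (0, 0, w) (0, 0, q))) (at p)"
    by (rule has_derivative_p_slice[OF D2L s p])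
  assume w: "w \<bullet> p = 0"
  \<comment> \<open>This is the skew map \<open>(w p^T - p w^T) / (p . p)\<close>; it sends
    \<open>p\<close> to \<open>w\<close> because the two are orthogonal.\<close>
  define J where "J = (\<lambda>x. ((x \<bullet> p) / (p \<bullet> p)) *\<^sub>R w - ((x \<bullet> w) / (p \<bullet> p)) *\<^sub>R p)"
  have "bounded_linear J"
    unfolding J_def
    by (intro bounded_linear_sub bounded_linear_compose[OF bounded_linear_scaleR_left]
        bounded_linear_compose[OF bounded_linear_divide] bounded_linear_inner_left)
  moreover have "J x \<bullet> x = 0" for x
    by (simp add: J_def inner_simps inner_commute)
  ultimately have "D2L (s, u, p) (0, 0, J p) (0, 0, q) = 0"
    by (intro hessian_skew[OF N s p])
  moreover have "J p = w" using p w by (simp add: J_def inner_commute)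
  ultimately show "D2L (s, u, p) (0, 0, w) (0, 0, q) = 0" by simp
qed

end

section \<open>From the vanishing Hessian to the local representation\<close>

theorem theorem5p1:
  fixes L :: "real \<Rightarrow> real ^ 'n \<Rightarrow> real ^ 'n \<Rightarrow> real"
  assumes "CARD('n) > 1"
    and "smooth_lagrangian L"
    and "N_lagrangian L"
  shows "\<forall>(s0, u0, p0) \<in> lagrangian_domain.
           \<exists>U. open U \<and> (s0, u0, p0) \<in> U \<and>
             (\<exists>(A :: real \<Rightarrow> real ^ 'n \<Rightarrow> real ^ 'n) (C :: real \<Rightarrow> real ^ 'n \<Rightarrow> real).
                \<forall>(s, u, p) \<in> U \<inter> lagrangian_domain. L s u p = p \<bullet> A s u + C s u)"
proof -
  have "Ck_on (Suc (Suc 0)) lagrangian_domain (\<lambda>(s, u, p). L s u p)"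
    using assms(2) unfolding smooth_lagrangian_def smooth_on_def by blast
  then obtain DL where
    DL: "\<forall>x\<in>lagrangian_domain. ((\<lambda>(s, u, p). L s u p) has_derivative DL x) (at x within lagrangian_domain)"
    and "\<forall>v. \<exists>D2. (\<forall>x\<in>lagrangian_domain. ((\<lambda>x. DL x v) has_derivative D2 x) (at x within lagrangian_domain))
        \<and> (\<forall>w. continuous_on lagrangian_domain (\<lambda>x. D2 x w))"
    unfolding Ck_on.simps by blast
  then obtain D2 where D2: "\<And>v. (\<forall>x\<in>lagrangian_domain. ((\<lambda>x. DL x v) has_derivative D2 v x) (at x within lagrangian_domain))
        \<and> (\<forall>w. continuous_on lagrangian_domain (\<lambda>x. D2 v x w))"
    by metis
  interpret lagrangian_jet L DL "\<lambda>x v. D2 v x"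
    using DL D2 by unfold_locales auto
  \<comment> \<open>This is the first-order Taylor expansion in \<open>p\<close> at
    \<open>p0\<close>; with \<open>p0\<close> fixed, its coefficients are functions of
    \<open>(s, u)\<close> only.\<close>
  have affine: "L s u p = p \<bullet> grad (L s u) p0 + (L s u p0 - p0 \<bullet> grad (L s u) p0)"
    if "s \<in> {0..1}" "p0 \<noteq> 0" "p \<in> ball p0 (norm p0)" for s u p p0
  proof -
    interpret slice: normal_degenerate_hessian "L s u" "\<lambda>p w. DL (s, u, p) (0, 0, w)"
      "\<lambda>p w q. D2 (0, 0, w) (s, u, p) (0, 0, q)"
      by (rule slice_normal_degenerate_hessian[OF assms(3) that(1)])
    have "L s u p = L s u p0 + DL (s, u, p0) (0, 0, p - p0)"
      by (rule slice.affine_on_ball[OF _ that(2,3)]) (use assms(1) in simp)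
    also have "DL (s, u, p0) (0, 0, p - p0) = grad (L s u) p0 \<bullet> (p - p0)"
      by (rule grad_inner_eq[OF has_derivative_L_p[OF that(1,2)], symmetric])
    finally show ?thesis by (simp add: inner_diff_left inner_commute)
  qed
  show ?thesis
  proof (safe)
    fix s0 :: real and u0 p0 :: "real ^ 'n"
    assume "(s0, u0, p0) \<in> lagrangian_domain"
    then have p0: "p0 \<noteq> 0" by (simp add: lagrangian_domain_def)
    \<comment> \<open>Only \<open>p\<close> needs restricting: the same \<open>p0\<close> works for
      every \<open>u\<close> and every \<open>s\<close> in \<open>{0..1}\<close>.\<close>
    define U where "U = (UNIV :: real set) \<times> (UNIV :: (real ^ 'n) set) \<times> ball p0 (norm p0)"
    let ?A = "\<lambda>s u. grad (L s u) p0" and ?C = "\<lambda>s u. L s u p0 - p0 \<bullet> grad (L s u) p0"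
    have U: "open U" unfolding U_def by (intro open_Times) auto
    have mem: "(s0, u0, p0) \<in> U" using p0 by (simp add: U_def)
    have repr: "\<forall>(s, u, p) \<in> U \<inter> lagrangian_domain. L s u p = p \<bullet> ?A s u + ?C s u"
    proof (intro ballI, clarify)
      fix s :: real and u p :: "real ^ 'n"
      assume "(s, u, p) \<in> U" "(s, u, p) \<in> lagrangian_domain"
      then have "s \<in> {0..1}" "p \<in> ball p0 (norm p0)" by (simp_all add: U_def lagrangian_domain_def)
      with p0 show "L s u p = p \<bullet> ?A s u + ?C s u" by (intro affine)
    qed
    show "\<exists>U. open U \<and> (s0, u0, p0) \<in> U \<and>
        (\<exists>A C. \<forall>(s, u, p) \<in> U \<inter> lagrangian_domain. L s u p = p \<bullet> A s u + C s u)"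
      by (rule exI[of _ U], rule conjI[OF U conjI[OF mem]], rule exI[of _ ?A], rule exI[of _ ?C], rule repr)
  qed
qed

end
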